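(* Let $a, b$ be relatively prime positive integers such that $\frac{5}{4} < \frac{a}{b} < \frac{4}{3}$. Then the $a$-uniform morphism $\varphi$ on $\mathbb{Z}_{\geq 0}$ defined by $\varphi(n) = 0^{5 a - 6 b - 1} \, 1 \, 0^{-2 a + 3 b - 1} \, 1 \, 0^{-2 a + 3 b - 1} \, (n+2)$ locates words of length $3 a - 3 b$ and is $\frac{a}{b}$-power-free.
   Context: Words are indexed from position $0$; a factor is a contiguous subword; $c^m$ denotes $m$ copies of the letter $c$. For relatively prime positive integers $a,b$ and a nonempty word $v$ whose length is divisible by $b$, define $v^{a/b} = v^{\lfloor a/b \rfloor} v_0 v_1 \cdots v_{t-1}$, where $t = |v|\,(a/b - \lfloor a/b\rfloor)$; such a word is called an $\frac{a}{b}$-power. A word is $\frac{a}{b}$-power-free if none of its factors is an $\frac{a}{b}$-power. A morphism $\varphi$ on an alphabet $\Sigma$ is a map $\Sigma \to \Sigma^*$, extended to words by concatenation; it is $k$-uniform if all images have length $k$. A morphism is $\frac{a}{b}$-power-free if $\varphi(w)$ is $\frac{a}{b}$-power-free for every finite $\frac{a}{b}$-power-free word $w$. A $k$-uniform morphism $\varphi$ on $\Sigma$ locates words of length $\ell$ if for each word $x$ of length $\ell$ there is an integer $j$ such that, for all $w \in \Sigma^*$, every occurrence of $x$ as a factor of $\varphi(w)$ begins at a position congruent to $j$ modulo $k$. *)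

theory Defs
  imports Complex_Main "HOL-Library.Sublist" "HOL-Number_Theory.Cong"
begin

text \<open>Words over an alphabet are lists over the corresponding type; a factor (contiguous
  subword) is a \<^const>\<open>sublist\<close> in the sense of \<^theory>\<open>HOL-Library.Sublist\<close>.\<close>

text \<open>The word \<open>v\<^bsup>a/b\<^esup>\<close>, for \<open>b\<close> dividing \<open>|v|\<close>.  Since
  \<open>\<lfloor>a/b\<rfloor> = a div b\<close> and \<open>a/b - \<lfloor>a/b\<rfloor> = (a mod b)/b\<close>, the length of the trailing partial
  period is \<open>|v| (a/b - \<lfloor>a/b\<rfloor>) = (|v| div b) * (a mod b)\<close>.\<close>

definition frac_power :: "nat \<Rightarrow> nat \<Rightarrow> 'a list \<Rightarrow> 'a list" where
  "frac_power a b v =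
     concat (replicate (a div b) v) @ take ((length v div b) * (a mod b)) v"

definition is_frac_power :: "nat \<Rightarrow> nat \<Rightarrow> 'a list \<Rightarrow> bool" where
  "is_frac_power a b u \<longleftrightarrow> (\<exists>v. v \<noteq> [] \<and> b dvd length v \<and> u = frac_power a b v)"

definition power_free :: "nat \<Rightarrow> nat \<Rightarrow> 'a list \<Rightarrow> bool" where
  "power_free a b w \<longleftrightarrow> (\<forall>u. sublist u w \<longrightarrow> \<not> is_frac_power a b u)"

text \<open>A morphism is given by its values on letters; this is its extension to words.\<close>

definition morph :: "('a \<Rightarrow> 'a list) \<Rightarrow> 'a list \<Rightarrow> 'a list" where
  "morph \<phi> w = concat (map \<phi> w)"

definition uniform_morphism :: "nat \<Rightarrow> ('a \<Rightarrow> 'a list) \<Rightarrow> bool" where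
  "uniform_morphism k \<phi> \<longleftrightarrow> (\<forall>c. length (\<phi> c) = k)"

definition power_free_morphism :: "nat \<Rightarrow> nat \<Rightarrow> ('a \<Rightarrow> 'a list) \<Rightarrow> bool" where
  "power_free_morphism a b \<phi> \<longleftrightarrow> (\<forall>w. power_free a b w \<longrightarrow> power_free a b (morph \<phi> w))"

text \<open>An occurrence of \<open>x\<close> in \<open>\<phi>(w)\<close> is a factorization \<open>\<phi>(w) = p x s\<close>; with positions counted
  from 0, it begins at position \<open>|p|\<close>.\<close>

definition locates_words :: "nat \<Rightarrow> ('a \<Rightarrow> 'a list) \<Rightarrow> nat \<Rightarrow> bool" where
  "locates_words k \<phi> l \<longleftrightarrow>
     (\<forall>x. length x = l \<longrightarrow>
        (\<exists>j::int. \<forall>w p s. morph \<phi> w = p @ x @ s \<longrightarrow> [int (length p) = j] (mod int k)))"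

text \<open>For \<open>5/4 < a/b < 4/3\<close> both \<open>5a - 6b - 1\<close> and \<open>-2a + 3b - 1\<close> are nonnegative, so the
  truncated subtraction on \<^typ>\<open>nat\<close> is the true one.\<close>

definition phi :: "nat \<Rightarrow> nat \<Rightarrow> nat \<Rightarrow> nat list" where
  "phi a b n =
     replicate (5 * a - 6 * b - 1) 0 @ [1] @
     replicate (3 * b - 2 * a - 1) 0 @ [1] @
     replicate (3 * b - 2 * a - 1) 0 @ [n + 2]"

end

theory Submission
  imports Defs
begin

text \<open>Put \<open>A = 5a - 6b\<close> and \<open>B = 3b - 2a\<close>, so that \<open>a = A + 2B\<close> and \<open>A + B = 3(a - b)\<close>, and the
  hypotheses on \<open>a/b\<close> say that \<open>a - b < A < 2(a - b)\<close> and \<open>a - b < B < 2(a - b)\<close>.  In an image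
  word the nonzero letters follow each other cyclically at distances \<open>A, B, B\<close>, and letters
  \<open>\<ge> 2\<close> occur exactly at the positions congruent to \<open>-1\<close> modulo \<open>a\<close>.  A window of length \<open>A + B\<close>
  therefore contains either such a letter or the second \<open>1\<close> of a block, which locates it.

  An \<open>a/b\<close>-power in an image word has length \<open>a m\<close> and period \<open>b m\<close>, so a factor of length
  \<open>(a - b) m\<close> recurs at distance \<open>b m\<close>.  If \<open>m \<ge> 3\<close> then locating forces \<open>a\<close> to divide \<open>m\<close>, and
  reading the last letters of the blocks gives an \<open>a/b\<close>-power in the preimage.  If \<open>m \<le> 2\<close>,
  two nonzero letters would be at distance \<open>-m(a - b)\<close> modulo \<open>a\<close>, which does not
  occur among the distances \<open>A\<close>, \<open>B\<close>, \<open>A + B\<close>, \<open>2B\<close>.\<close>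

section \<open>Letters of images under uniform morphisms\<close>

lemma length_morph:
  assumes "uniform_morphism k \<phi>"
  shows "length (morph \<phi> w) = k * length w"
  using assms by (induction w) (auto simp: morph_def uniform_morphism_def)

lemma nth_morph:
  assumes "uniform_morphism k \<phi>" and "i < k * length w"
  shows "morph \<phi> w ! i = \<phi> (w ! (i div k)) ! (i mod k)"
  using assms(2)
proof (induction w arbitrary: i)
  case Nil
  then show ?case by simp
next
  case (Cons c w)
  have len: "length (\<phi> c) = k" and "k > 0"
    using assms(1) Cons.prems by (auto simp: uniform_morphism_def intro: Nat.gr0I)
  show ?case
  proof (cases "i < k")
    case True
    then show ?thesis using len by (simp add: morph_def nth_append)
  next
    case False
    then have "i div k = Suc ((i - k) div k)" "i mod k = (i - k) mod k"
      using \<open>k > 0\<close> by (simp_all add: le_div_geq le_mod_geq)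
    moreover have "morph \<phi> w ! (i - k) = \<phi> (w ! ((i - k) div k)) ! ((i - k) mod k)"
      using Cons.prems False by (intro Cons.IH) auto
    ultimately show ?thesis using False len by (simp add: morph_def nth_append)
  qed
qed

text \<open>Adding less than \<open>a\<close> wraps around at most once; the additive form avoids
  truncated subtraction.\<close>

lemma mod_add_less_cases:
  fixes p d a :: nat
  assumes "d < a"
  shows "(p + d) mod a = p mod a + d \<or> a + (p + d) mod a = p mod a + d"
proof -
  have "(p + d) mod a = (p mod a + d) mod a" by (simp add: mod_simps)
  moreover have "p mod a < a" using assms by simp
  ultimately show ?thesis
    using assms by (cases "p mod a + d < a") (simp_all add: le_mod_geq)
qed

section \<open>Fractional powers as words with a period\<close>

text \<open>Since 1 < a/b < 2, the power is \<open>v\<close> followed by a prefix of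
  \<open>v\<close>, so with \<open>length v = b * m\<close> it is a word of length
  \<open>a * m\<close> with period \<open>b * m\<close>.\<close>

lemma is_frac_power_iff:
  fixes u :: "'a list"
  assumes "b < a" and "a < 2 * b"
  shows "is_frac_power a b u \<longleftrightarrow>
    (\<exists>m>0. length u = a * m \<and> (\<forall>i<(a - b) * m. u ! (i + b * m) = u ! i))"
proof
  have eq: "frac_power a b v = v @ take ((a - b) * m) v" if "length v = b * m" for v :: "'a list" and m
  proof -
    have "a div b = 1" "a mod b = a - b" using assms by (simp_all add: div_if mod_if)
    then show ?thesis using that assms by (simp add: frac_power_def mult.commute)
  qed
  have len: "a * m = b * m + (a - b) * m" "(a - b) * m \<le> b * m" for m
    using assms by (simp flip: add_mult_distrib, intro mult_le_mono1, simp)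
  {
    assume "is_frac_power a b u"
    then obtain v where v: "v \<noteq> []" "b dvd length v" "u = frac_power a b v"
      by (auto simp: is_frac_power_def)
    then obtain m where m: "length v = b * m" by (elim dvdE)
    have "m > 0" using m v(1) by (auto intro: Nat.gr0I)
    moreover have "length u = a * m" using v(3) eq[OF m] m len[of m] by simp
    moreover have "\<forall>i<(a - b) * m. u ! (i + b * m) = u ! i"
    proof (intro allI impI)
      fix i assume i: "i < (a - b) * m"
      then have "i < b * m" using len(2)[of m] by linarith
      then show "u ! (i + b * m) = u ! i"
        unfolding v(3) eq[OF m] using i m by (simp add: nth_append)
    qed
    ultimately show "\<exists>m>0. length u = a * m \<and> (\<forall>i<(a - b) * m. u ! (i + b * m) = u ! i)"
      by blast
  next
    assume "\<exists>m>0. length u = a * m \<and> (\<forall>i<(a - b) * m. u ! (i + b * m) = u ! i)"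
    then obtain m where m: "m > 0" "length u = a * m"
      and per: "\<And>i. i < (a - b) * m \<Longrightarrow> u ! (i + b * m) = u ! i" by blast
    define v where "v = take (b * m) u"
    have v: "length v = b * m" using m len[of m] by (simp add: v_def)
    have "u = v @ take ((a - b) * m) v"
    proof (rule nth_equalityI)
      show "length u = length (v @ take ((a - b) * m) v)" using v m len[of m] by simp
      fix i assume "i < length u"
      then show "u ! i = (v @ take ((a - b) * m) v) ! i"
        using v m len[of m] per[of "i - b * m"] by (auto simp: nth_append v_def)
    qed
    moreover have "v \<noteq> []" using v m assms by auto
    ultimately show "is_frac_power a b u"
      unfolding is_frac_power_def using v eq[OF v] by (intro exI[of _ v]) simp
  }
qed

lemma power_free_iff:
  fixes w :: "'a list"
  assumes "b < a" and "a < 2 * b"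
  shows "power_free a b w \<longleftrightarrow>
    (\<nexists>p m. m > 0 \<and> p + a * m \<le> length w \<and> (\<forall>i<(a - b) * m. w ! (p + i + b * m) = w ! (p + i)))"
proof -
  have sum: "i + b * m < a * m" "i < a * m" if "i < (a - b) * m" for i m
  proof -
    have "a * m = b * m + (a - b) * m" using assms by (simp flip: add_mult_distrib)
    then show "i + b * m < a * m" "i < a * m" using that by simp_all
  qed
  have "(\<exists>u. sublist u w \<and> is_frac_power a b u) \<longleftrightarrow>
    (\<exists>p m. m > 0 \<and> p + a * m \<le> length w \<and> (\<forall>i<(a - b) * m. w ! (p + i + b * m) = w ! (p + i)))"
    (is "?L \<longleftrightarrow> ?R")
  proof
    assume ?L
    then obtain xs u ys m where w: "w = xs @ u @ ys" and m: "m > 0" "length u = a * m"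
      and per: "\<forall>i<(a - b) * m. u ! (i + b * m) = u ! i"
      using is_frac_power_iff[OF assms, where ?'a = 'a] by (auto simp: sublist_def)
    have "w ! (length xs + i + b * m) = w ! (length xs + i)" if "i < (a - b) * m" for i
      using per that sum[OF that] m w by (simp add: nth_append)
    moreover have "length xs + a * m \<le> length w" using w m by simp
    ultimately show ?R using m by blast
  next
    assume ?R
    then obtain p m where m: "m > 0" "p + a * m \<le> length w"
      and per: "\<forall>i<(a - b) * m. w ! (p + i + b * m) = w ! (p + i)" by blast
    define u where "u = take (a * m) (drop p w)"
    have len: "length u = a * m" using m by (simp add: u_def)
    moreover have "u ! (i + b * m) = u ! i" if "i < (a - b) * m" for i
      using per that sum[OF that] m by (simp add: u_def add.assoc)
    moreover have "sublist u w"
      unfolding u_def by (meson sublist_drop sublist_order.order_trans sublist_take)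
    ultimately show ?L using m is_frac_power_iff[OF assms, of u] by blast
  qed
  then show ?thesis unfolding power_free_def by blast
qed

section \<open>The blocks of \<open>phi\<close>: nonzero letters and location of factors\<close>

context
  fixes a b A B c :: nat
  assumes a_eq: "a = A + 2 * B" and b_eq: "a = b + c" and AB: "A + B = 3 * c"
    and bounds: "c < A" "c < B"
begin

lemma a_bounds: "b < a" "a < 2 * b"
  using a_eq b_eq AB bounds by linarith+

lemma phi_eq:
  "phi a b n = replicate (A - 1) 0 @ [1] @ replicate (B - 1) 0 @ [1] @ replicate (B - 1) 0 @ [n + 2]"
proof -
  have "5 * a = 6 * b + A" "3 * b = 2 * a + B" using a_eq b_eq AB by linarith+
  then show ?thesis by (simp add: phi_def)
qed

lemma uniform_phi: "uniform_morphism a (phi a b)"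
proof -
  have "A - 1 + (1 + (B - 1 + (1 + (B - 1 + 1)))) = a" using bounds a_eq by linarith
  then show ?thesis by (simp add: uniform_morphism_def phi_eq)
qed

text \<open>The offsets of the nonzero letters in a block; \<open>r + 1\<close> avoids the truncated
  \<open>A - 1\<close>.\<close>

definition marked :: "nat \<Rightarrow> bool" where
  "marked r \<longleftrightarrow> r + 1 = A \<or> r + 1 = A + B \<or> r + 1 = A + 2 * B"

lemma nth_phi:
  assumes "r < a"
  shows "phi a b n ! r = (if r + 1 = a then n + 2 else if marked r then 1 else 0)"
proof -
  obtain A' B' where AB': "A = Suc A'" "B = Suc B'"
    using bounds by (metis less_imp_Suc_add)
  have *: "phi a b n = replicate A' 0 @ [1] @ replicate B' 0 @ [1] @ replicate B' 0 @ [n + 2]"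
    by (simp add: phi_eq AB')
  consider "r < A'" | "r = A'" | k where "r = A' + 1 + k" "k < B'" | "r = A' + 1 + B'"
    | k where "r = A' + 1 + B' + 1 + k" "k < B'" | "r = A' + 1 + B' + 1 + B'"
  proof -
    have "r < A' \<or> r = A' \<or> (A' + 1 \<le> r \<and> r < A' + 1 + B') \<or> r = A' + 1 + B'
      \<or> (A' + 1 + B' + 1 \<le> r \<and> r < A' + 1 + B' + 1 + B') \<or> r = A' + 1 + B' + 1 + B'"
      using assms a_eq AB' by linarith
    then show ?thesis using that by (metis add_less_cancel_left le_Suc_ex)
  qed
  then show ?thesis
    unfolding * unfolding a_eq marked_def by cases (simp_all add: nth_append AB')
qed

lemma nth_morph_phi:
  assumes "i < a * length w"
  shows "morph (phi a b) w ! i =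
    (if i mod a + 1 = a then w ! (i div a) + 2 else if marked (i mod a) then 1 else 0)"
proof -
  have "i mod a < a" using a_bounds by simp
  then show ?thesis using nth_morph[OF uniform_phi assms] nth_phi by simp
qed

lemma nth_morph_phi_eq_0_iff:
  assumes "i < a * length w"
  shows "morph (phi a b) w ! i = 0 \<longleftrightarrow> \<not> marked (i mod a)"
  using nth_morph_phi[OF assms] by (simp add: marked_def a_eq)

text \<open>The cyclic gaps are \<open>A\<close>, \<open>B\<close>, \<open>B\<close>. Both exceed
  \<open>c\<close> and sum to \<open>3 * c\<close>, so each is below \<open>2 * c\<close>.\<close>

lemma marked_in_window: "\<exists>i<2 * c. marked ((p + i) mod a)"
proof -
  define r where "r = p mod a"
  have "r < a" using a_bounds by (simp add: r_def)
  then consider "r < A" | "A \<le> r" "r < A + B" | "A + B \<le> r" "r < A + 2 * B"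
    unfolding a_eq by linarith
  then obtain i where i: "i < 2 * c" "marked (r + i)"
  proof cases
    case 1
    then obtain i where "A = Suc (r + i)" using less_imp_Suc_add by blast
    moreover have "i < 2 * c" using calculation AB bounds by linarith
    ultimately show ?thesis using that[of i] unfolding marked_def by simp
  next
    case 2
    then obtain i where "A + B = Suc (r + i)" using less_imp_Suc_add by blast
    then show ?thesis using that[of i] 2 AB bounds unfolding marked_def by simp
  next
    case 3
    then obtain i where "A + 2 * B = Suc (r + i)" using less_imp_Suc_add by blast
    then show ?thesis using that[of i] 3 AB bounds unfolding marked_def by simp
  qed
  have "r + i < a" using i(2) a_eq by (auto simp: marked_def)
  then have "(p + i) mod a = r + i" unfolding r_def by (metis mod_add_left_eq mod_less)
  then show ?thesis using i by auto
qed

text \<open>Cyclic distances between distinct marked offsets are \<open>A\<close> and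
  \<open>B\<close>, strictly between \<open>c\<close> and \<open>2 * c\<close>, or
  \<open>A + B\<close> and \<open>2 * B\<close>, which are larger.\<close>

lemma marked_diff:
  assumes "marked r" "marked s" and "m = 1 \<or> m = 2"
  shows "\<not> (r = s + c * m \<or> a + r = s + c * m)"
proof
  assume "r = s + c * m \<or> a + r = s + c * m"
  moreover have "c * m = c \<or> c * m = 2 * c" using assms(3) by auto
  ultimately show False
    using assms(1,2) AB bounds a_eq unfolding marked_def by - (elim disjE; linarith)
qed

text \<open>As \<open>b = a - c\<close>, a shift by \<open>b * m\<close> is a shift by
  \<open>- c * m\<close> modulo \<open>a\<close>.\<close>

lemma not_marked_shift:
  assumes "marked (p mod a)" and "m = 1 \<or> m = 2"
  shows "\<not> marked ((p + b * m) mod a)"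
proof
  assume marked: "marked ((p + b * m) mod a)"
  have "c * m < a" using assms(2) a_eq AB bounds by auto
  moreover have "(p + b * m + c * m) mod a = p mod a"
  proof -
    have "p + b * m + c * m = p + m * a" by (simp add: b_eq algebra_simps)
    then show ?thesis by (metis mod_mult_self1)
  qed
  ultimately have "p mod a = (p + b * m) mod a + c * m \<or> a + p mod a = (p + b * m) mod a + c * m"
    using mod_add_less_cases[of "c * m" a "p + b * m"] by simp
  then show False using marked_diff[OF assms(1) marked assms(2)] by blast
qed

text \<open>The second \<open>1\<close> of a block also locates the window: two different positions would differ
  by a distance between marked positions, hence by at least \<open>B\<close>.\<close>

lemma occurrences_cong:
  assumes le: "p + 3 * c \<le> a * length w" "q + 3 * c \<le> a * length w'"
    and eq: "\<And>i. i < 3 * c \<Longrightarrow> morph (phi a b) w ! (p + i) = morph (phi a b) w' ! (q + i)"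
  shows "p mod a = q mod a"
proof (cases "\<exists>i<3 * c. (p + i) mod a + 1 = a \<or> (q + i) mod a + 1 = a")
  case True
  then obtain i where i: "i < 3 * c" "(p + i) mod a + 1 = a \<or> (q + i) mod a + 1 = a"
    by blast
  \<comment> \<open>The last letter of a block is at least 2, all others are at most 1.\<close>
  have "(p + i) mod a + 1 = a \<and> (q + i) mod a + 1 = a"
    using i eq[OF i(1)] le nth_morph_phi[of "p + i" w] nth_morph_phi[of "q + i" w']
    by (auto split: if_splits)
  then have "[p + i = q + i] (mod a)" unfolding cong_def by linarith
  then have "[p = q] (mod a)" by (simp only: cong_add_rcancel_nat)
  then show ?thesis by (simp add: cong_def)
next
  case False
  have mod_eq: "(x + i) mod a = x mod a + i" if "x mod a + i < a" for x i
    using that by (metis mod_add_left_eq mod_less)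
  \<comment> \<open>The window has length \<open>A + B\<close> and stops before the last letter of
    its block, whose length is \<open>A + 2 * B\<close>.\<close>
  have less_B: "x mod a < B" if "\<forall>i<3 * c. (x + i) mod a + 1 \<noteq> a" for x
  proof (rule ccontr)
    assume "\<not> ?thesis"
    moreover have "x mod a < a" using a_bounds by simp
    then obtain i where i: "x mod a + i + 1 = a" by (metis Suc_eq_plus1 add_Suc_right less_imp_Suc_add)
    ultimately have "i < 3 * c" using AB a_eq by linarith
    then show False using that mod_eq[of x i] i by (metis Suc_eq_plus1 lessI)
  qed
  have r: "p mod a < B" and s: "q mod a < B" using False less_B by blast+
  have marked_iff: "marked ((p + i) mod a) \<longleftrightarrow> marked ((q + i) mod a)" if "i < 3 * c" for i
    using eq[OF that] that le nth_morph_phi_eq_0_iff[of "p + i" w]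
      nth_morph_phi_eq_0_iff[of "q + i" w'] by simp
  \<comment> \<open>\<open>i\<close> and \<open>j\<close> are the places of the second 1 of the
    block in the two windows.\<close>
  obtain i where i: "p mod a + i + 1 = A + B"
    using less_imp_Suc_add[of "p mod a" "A + B"] r by auto
  obtain j where j: "q mod a + j + 1 = A + B"
    using less_imp_Suc_add[of "q mod a" "A + B"] s by auto
  have "marked (q mod a + i)"
    using marked_iff[of i] mod_eq[of p i] mod_eq[of q i] i r s AB a_eq by (simp add: marked_def)
  moreover have "marked (p mod a + j)"
    using marked_iff[of j] mod_eq[of p j] mod_eq[of q j] j r s AB a_eq by (simp add: marked_def)
  ultimately show ?thesis
    using i j r s unfolding marked_def by - (elim disjE; linarith)
qed

lemma locates_words_phi: "locates_words a (phi a b) (3 * c)"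
  unfolding locates_words_def
proof (intro allI impI)
  fix x :: "nat list"
  assume x: "length x = 3 * c"
  have unique: "[int (length p) = int (length q)] (mod int a)"
    if p: "morph (phi a b) w = p @ x @ s" and q: "morph (phi a b) w' = q @ x @ t" for w p s w' q t
  proof -
    have "a * length w = length (p @ x @ s)" "a * length w' = length (q @ x @ t)"
      using length_morph[OF uniform_phi, of w] length_morph[OF uniform_phi, of w'] p q by simp_all
    then have "length p mod a = length q mod a"
      using p q x by (intro occurrences_cong[of _ w _ w']) (auto simp: nth_append)
    then show ?thesis unfolding cong_int_iff by (simp add: cong_def)
  qed
  show "\<exists>j::int. \<forall>w p s. morph (phi a b) w = p @ x @ s \<longrightarrow> [int (length p) = j] (mod int a)"
  proof (cases "\<exists>w p s. morph (phi a b) w = p @ x @ s")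
    case True
    then show ?thesis using unique by blast
  qed blast
qed

section \<open>Power-freeness\<close>

lemma power_free_phi:
  assumes "coprime a b"
  shows "power_free_morphism a b (phi a b)"
  unfolding power_free_morphism_def
proof (intro allI impI)
  fix w :: "nat list"
  assume free: "power_free a b w"
  note ab = a_bounds
  have c: "a - b = c" using b_eq by simp
  let ?W = "morph (phi a b) w"
  have lenW: "length ?W = a * length w" by (rule length_morph[OF uniform_phi])
  show "power_free a b ?W"
    unfolding power_free_iff[OF ab] lenW c
  proof (intro notI, elim exE conjE)
    fix p m
    assume m: "m > 0" and le: "p + a * m \<le> a * length w"
      and per: "\<forall>i<c * m. ?W ! (p + i + b * m) = ?W ! (p + i)"
    have am: "a * m = b * m + c * m" by (simp add: b_eq add_mult_distrib)
    have marked_iff: "marked ((p + i) mod a) \<longleftrightarrow> marked ((p + i + b * m) mod a)"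
      if "i < c * m" for i
      using per that le am nth_morph_phi_eq_0_iff[of "p + i" w]
        nth_morph_phi_eq_0_iff[of "p + i + b * m" w] by simp
    \<comment> \<open>For \<open>m \<le> 2\<close> both copies of the repeated factor consist of
      zeros only.\<close>
    have not_marked: "\<not> marked ((p + i) mod a)" "\<not> marked ((p + i + b * m) mod a)"
      if "i < c * m" "m = 1 \<or> m = 2" for i
      using marked_iff[OF that(1)] not_marked_shift[of "p + i" m] that(2) by auto
    consider "m = 1" | "m = 2" | "m \<ge> 3" using m by linarith
    then show False
    proof cases
      case 1
      \<comment> \<open>The two occurrences, of length \<open>a - b\<close>, are adjacent modulo \<open>a\<close> and together form a
        window of length \<open>2 (a - b)\<close>.\<close>
      obtain i where i: "i < 2 * c" "marked ((p + b + i) mod a)"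
        using marked_in_window by blast
      show False
      proof (cases "i < c")
        case True
        then show False using not_marked(2)[of i] i(2) 1 by (simp add: ac_simps)
      next
        case False
        then have "p + b + i = (p + (i - c)) + a" using b_eq by simp
        then have "(p + b + i) mod a = (p + (i - c)) mod a" by (metis mod_add_self2)
        then show False using not_marked(1)[of "i - c"] i 1 False by simp
      qed
    next
      case 2
      \<comment> \<open>The first copy alone already has length \<open>2 * c\<close>.\<close>
      then show False using marked_in_window[of p] not_marked(1) by (auto simp: mult.commute)
    next
      case 3
      then have three: "3 * c \<le> c * m" by (simp add: mult.commute)
      have "p mod a = (p + b * m) mod a"
      proof (rule occurrences_cong[of _ w _ w])
        show "p + 3 * c \<le> a * length w" "p + b * m + 3 * c \<le> a * length w"
          using three le am by linarith+
        show "?W ! (p + i) = ?W ! (p + b * m + i)" if "i < 3 * c" for i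
        proof -
          have "i < c * m" using that three by linarith
          then have "?W ! (p + i + b * m) = ?W ! (p + i)" using per by blast
          then show ?thesis by (simp add: ac_simps)
        qed
      qed
      then have "a dvd b * m" using mod_eq_dvd_iff_nat[of p "p + b * m" a] by simp
      then have "a dvd m" using assms by (simp add: coprime_dvd_mult_right_iff)
      then obtain k where k: "m = a * k" by blast
      \<comment> \<open>The block of \<open>w\<close> in which the power starts; the power in
        \<open>w\<close> will start there too.\<close>
      define s where "s = p div a"
      have s: "a * s \<le> p" "p < a * s + a"
        using ab dividend_less_times_div[of a p] by (simp_all add: s_def)
      \<comment> \<open>The offset of the only letter of a block that depends on
        \<open>w\<close>.\<close>
      define e where "e = a - 1"
      have e: "e + 1 = a" "e < a" using ab by (simp_all add: e_def)
      have letter: "?W ! (a * j + e) = w ! j + 2" if "j < length w" for j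
      proof -
        have "a * (j + 1) \<le> a * length w" using that by (intro mult_le_mono2) simp
        then have "a * j + e < a * length w" using e by (simp add: algebra_simps)
        moreover have "(a * j + e) div a = j" "(a * j + e) mod a = e" using e by simp_all
        ultimately show ?thesis using nth_morph_phi[of "a * j + e" w] e by simp
      qed
      have "a * (s + m) \<le> a * length w" using s le by (simp add: algebra_simps)
      then have sm: "s + m \<le> length w" using ab by simp
      have "w ! (s + i + b * k) = w ! (s + i)" if i: "i < c * k" for i
      proof -
        have "i + b * k < a * k"
        proof -
          have "a * k = b * k + c * k" by (simp add: b_eq add_mult_distrib)
          then show ?thesis using i by simp
        qed
        then have j: "s + i + b * k < length w" "s + i < length w" using sm k by simp_all
        \<comment> \<open>The distance from \<open>p\<close> to the last letter of block
          \<open>s + i\<close>. It is not truncated, because \<open>p\<close> lies in block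
          \<open>s\<close>.\<close>
        define h where "h = a * (s + i) + e - p"
        have h: "p + h = a * (s + i) + e"
          using s e by (simp add: h_def algebra_simps)
        have "a * (i + 1) \<le> a * (c * k)" using i by (intro mult_le_mono2) simp
        then have "h < c * m" using s e h k by (simp add: algebra_simps)
        then have "?W ! (p + h + b * m) = ?W ! (p + h)" using per by blast
        \<comment> \<open>The shift by \<open>b * m = a * (b * k)\<close> moves by exactly
          \<open>b * k\<close> blocks.\<close>
        moreover have "p + h + b * m = a * (s + i + b * k) + e"
          using h k by (simp add: algebra_simps)
        ultimately show ?thesis using letter[OF j(1)] letter[OF j(2)] h by (metis add_right_cancel)
      qed
      moreover have "s + a * k \<le> length w" "k > 0" using sm k m by auto
      ultimately show False using free unfolding power_free_iff[OF ab] c by blast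
    qed
  qed
qed

end

theorem theorem4p6:
  fixes a b :: nat
  assumes "a > 0" and "b > 0" and "coprime a b"
    and "5 / 4 < real a / real b" and "real a / real b < 4 / 3"
  shows "uniform_morphism a (phi a b)
    \<and> locates_words a (phi a b) (3 * a - 3 * b)
    \<and> power_free_morphism a b (phi a b)"
proof -
  have lower: "5 * b < 4 * a" and upper: "3 * a < 4 * b" using assms by (simp_all add: field_simps)
  define c where "c = a - b"
  define A where "A = 5 * a - 6 * b"
  define B where "B = 3 * b - 2 * a"
  have c: "a = b + c" using lower upper by (simp add: c_def)
  \<comment> \<open>Both subtractions are exact, since 6/5 < 5/4 and 4/3 < 3/2.\<close>
  have "5 * a = 6 * b + A" "3 * b = 2 * a + B"
    using lower upper by (simp_all add: A_def B_def)
  \<comment> \<open>\<open>c < A\<close> amounts to \<open>5 * b < 4 * a\<close>, and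
    \<open>c < B\<close> to \<open>3 * a < 4 * b\<close>.\<close>
  then have "a = A + 2 * B" "A + B = 3 * c" "c < A" "c < B"
    using c lower upper by linarith+
  note * = this(1) c this(2-)
  have "3 * a - 3 * b = 3 * c" by (simp add: c_def)
  then show ?thesis
    using uniform_phi[OF *] locates_words_phi[OF *] power_free_phi[OF * assms(3)] by simp
qed

end
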